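(* Let $\mathbf{K}=\bigcup_n\mathbf{A}_n$ be a Fraïssé $L$-structure with a fixed exhaustion, let $\mathcal{K}=\{\mathbf{A}:\mathbf{A}\cong\mathbf{A}_n\text{ for some }n<\omega\}$, and suppose $\mathbf{K}$ admits a big Ramsey structure $\mathbf{K}'$. Let $\mathcal{K}'$ be the big Ramsey expansion of $\mathcal{K}$. Then $\mathcal{K}'$ and $\mathrm{Age}(\mathbf{K}'/\mathcal{K})$ are isomorphic expansions of $\mathcal{K}$.
   Context: Relational languages; $\mathbf{K}$ Fraïssé means countable and every embedding of a finite substructure into $\mathbf{K}$ extends to an automorphism. Exhaustion: finite substructures $\emptyset=\mathbf{A}_0\subseteq\mathbf{A}_1\subseteq\cdots$ with union $\mathbf{K}$. $H_m=\mathrm{Emb}(\mathbf{A}_m,\mathbf{K})$, $H_m^n=\mathrm{Emb}(\mathbf{A}_m,\mathbf{A}_n)$, $\widehat G=\mathrm{Emb}(\mathbf{K},\mathbf{K})$. For a set $A$, structure $\mathbf{B}$ and injection $f:A\to B$, $\mathbf{B}\cdot f$ is the unique structure on $A$ making $f$ an embedding into $\mathbf{B}$. Big Ramsey degree of a finite $\mathbf{A}\le\mathbf{K}$: least $\ell$ such that for every $r>\ell$ and every $\gamma:\mathrm{Emb}(\mathbf{A},\mathbf{K})\to r$ there is $\eta\in\mathrm{Emb}(\mathbf{K})$ with $|\{\gamma(\eta\circ f)\}|\le\ell$. A big Ramsey structure is an $L'$-structure $\mathbf{K}'$ ($L'\supseteq L$) with $\mathbf{K}'|_L=\mathbf{K}$,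 such that each finite $\mathbf{A}\in\mathrm{Age}(\mathbf{K})$ has finitely many expansions in $\mathrm{Age}(\mathbf{K}')$ (set $\mathbf{K}'(\mathbf{A})$), $\mathbf{A}$ has big Ramsey degree $|\mathbf{K}'(\mathbf{A})|$, and $\{\mathbf{K}'\cdot(\eta\circ f):f\in\mathrm{Emb}(\mathbf{A},\mathbf{K})\}=\mathbf{K}'(\mathbf{A})$ for every $\eta\in\mathrm{Emb}(\mathbf{K})$. In particular each $\mathbf{A}_n$ has finite big Ramsey degree, denoted $R_n$. Colorings: a set $S\subseteq H_m$ is unavoidable if $\{f\in H_m:\eta\circ f\in S\}\ne\emptyset$ for all $\eta\in\widehat G$; an unavoidable $k$-coloring of $H_m$ is a map $\gamma$ from $H_m$ to a finite set with $|\mathrm{im}\gamma|=k$ whose nonempty fibers are unavoidable. For colorings $\gamma$ of $H_m$ and $\delta$ of $H_n$ ($m\le n$), $\gamma\ll\delta$ means that for all $f\in H_m^n$ and $s_0,s_1\in H_n$, $\delta(s_0)=\delta(s_1)\Rightarrow\gamma(s_0\circ f)=\gamma(s_1\circ f)$. Expansions: an expansion of $\mathcal{K}$ is a class $\mathcal{K}^*$ of $L^*$-structures ($L^*\supseteq L$) such that (1) $\mathbf{A}^*|_L\in\mathcal{K}$ for $\mathbf{A}^*\in\mathcal{K}^*$; (2) every $\mathbf{A}\in\mathcal{K}$ has some $\mathbf{A}^*\in\mathcal{K}^*$ with $\mathbf{A}^*|_L=\mathbf{A}$ (the set of these is $\mathcal{K}^*(\mathbf{A})$); (3) if $\mathbf{A}\in\mathcal{K}$,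 $\mathbf{B}^*\in\mathcal{K}^*$ and $f:\mathbf{A}\to\mathbf{B}^*|_L$ is an embedding, then $\mathbf{B}^*\cdot f\in\mathcal{K}^*(\mathbf{A})$. It is precompact if every $\mathcal{K}^*(\mathbf{A})$ is finite, and reasonable if for every embedding $f:\mathbf{A}\to\mathbf{B}$ with $\mathbf{A},\mathbf{B}\in\mathcal{K}$ the map $\mathcal{K}^*(\mathbf{B})\to\mathcal{K}^*(\mathbf{A})$, $\mathbf{B}^*\mapsto\mathbf{B}^*\cdot f$, is surjective. Two expansions $\mathcal{K}^*,\mathcal{K}^\dagger$ are isomorphic if there is a bijection $\Phi:\bigcup_n\mathcal{K}^*(\mathbf{A}_n)\to\bigcup_n\mathcal{K}^\dagger(\mathbf{A}_n)$ sending $\mathcal{K}^*(\mathbf{A}_n)$ into $\mathcal{K}^\dagger(\mathbf{A}_n)$ and with $\Phi(\mathbf{A}_n^*\cdot f)=\Phi(\mathbf{A}_n^* )\cdot f$ for all $m\le n$, $f\in H_m^n$, $\mathbf{A}_n^*\in\mathcal{K}^*(\mathbf{A}_n)$. For an $L^*$-structure $\mathbf{K}^*$ with $\mathbf{K}^*|_L=\mathbf{K}$, $\mathrm{Age}(\mathbf{K}^*/\mathcal{K})=\{\mathbf{A}^*:\mathbf{A}^*\cong\mathbf{K}^*\cdot s\text{ for some }n<\omega,\ s\in H_n\}$. Big Ramsey expansion: a reasonable, precompact expansion $\mathcal{K}'$ of $\mathcal{K}$ such that for every $r<\omega$ there are unavoidable $R_n$-colorings $\gamma_n$ of $H_n$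 ($n<r$) with $\gamma_m\ll\gamma_n$ for $m\le n<r$, and bijections $\sigma_n:\mathrm{im}(\gamma_n)\to\mathcal{K}'(\mathbf{A}_n)$ ($n<r$), such that $\sigma_m(\gamma_m(s\circ f))=\sigma_n(\gamma_n(s))\cdot f$ for all $m\le n<r$, $s\in H_n$, $f\in H_m^n$. (Such an expansion exists and is unique up to isomorphism of expansions.) *)

theory Defs
  imports "HOL-Library.FuncSet" "HOL-Library.Extended_Nat" "HOL-Library.Countable_Set"
begin

section \<open>Relational structures\<close>

text \<open>A relational language is a partial function giving each of its symbols an arity, so that
  \<open>L \<subseteq>\<^sub>m L'\<close> says that \<open>L'\<close> contains \<open>L\<close>. Symbols outside the language are interpreted by the
  empty relation, so that equality in this type is equality of \<open>L\<close>-structures.\<close>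

type_synonym 'r lang = "'r \<rightharpoonup> nat"

datatype ('a, 'r) struct = Struct (carrier: "'a set") (rel: "'r \<Rightarrow> 'a list set")

definition is_structure :: "'r lang \<Rightarrow> ('a, 'r) struct \<Rightarrow> bool" where
  "is_structure L A \<longleftrightarrow>
     (\<forall>R. case L R of
            None \<Rightarrow> rel A R = {}
          | Some k \<Rightarrow> rel A R \<subseteq> {xs. length xs = k \<and> set xs \<subseteq> carrier A})"

definition reduct :: "'r lang \<Rightarrow> ('a, 'r) struct \<Rightarrow> ('a, 'r) struct" where
  "reduct L A = Struct (carrier A) (\<lambda>R. if R \<in> dom L then rel A R else {})"

definition substructure :: "('a, 'r) struct \<Rightarrow> ('a, 'r) struct \<Rightarrow> bool" where
  "substructure A B \<longleftrightarrow> carrier A \<subseteq> carrier B \<and> (\<forall>R. rel A R = rel B R \<inter> lists (carrier A))"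

text \<open>Embeddings are extensional functions on the carrier, so the composition of \<open>f \<in> Emb A B\<close>
  with \<open>g \<in> Emb B C\<close> is \<open>compose (carrier A) g f\<close>. No language is mentioned: if \<open>A\<close> and \<open>B\<close>
  are \<open>L\<close>-structures, the condition is vacuous for symbols outside \<open>L\<close>. For a map into an
  \<open>L*\<close>-structure \<open>B\<close> to be an embedding of \<open>L\<close>-structures, use \<open>reduct L B\<close>.\<close>

definition Emb :: "('a, 'r) struct \<Rightarrow> ('a, 'r) struct \<Rightarrow> ('a \<Rightarrow> 'a) set" where
  "Emb A B = {f \<in> carrier A \<rightarrow>\<^sub>E carrier B. inj_on f (carrier A) \<and>
     (\<forall>R. \<forall>xs \<in> lists (carrier A). xs \<in> rel A R \<longleftrightarrow> map f xs \<in> rel B R)}"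

definition Aut :: "('a, 'r) struct \<Rightarrow> ('a \<Rightarrow> 'a) set" where
  "Aut A = {f \<in> Emb A A. f ` carrier A = carrier A}"

definition isomorphic :: "('a, 'r) struct \<Rightarrow> ('a, 'r) struct \<Rightarrow> bool" where
  "isomorphic A B \<longleftrightarrow> (\<exists>f \<in> Emb A B. f ` carrier A = carrier B)"

text \<open>\<open>pullback X B f\<close> is the structure \<open>B \<cdot> f\<close> on the domain \<open>X\<close> of the injection \<open>f\<close>.\<close>

definition pullback :: "'a set \<Rightarrow> ('a, 'r) struct \<Rightarrow> ('a \<Rightarrow> 'a) \<Rightarrow> ('a, 'r) struct" where
  "pullback X B f = Struct X (\<lambda>R. {xs \<in> lists X. map f xs \<in> rel B R})"

lemma pullback_unique:
  assumes "is_structure L B" and "f \<in> X \<rightarrow>\<^sub>E carrier B" and "inj_on f X"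
  shows "is_structure L A \<and> carrier A = X \<and> f \<in> Emb A B \<longleftrightarrow> A = pullback X B f"
proof
  assume A: "is_structure L A \<and> carrier A = X \<and> f \<in> Emb A B"
  have sub: "rel A R \<subseteq> lists X" for R
    using A by (auto simp: is_structure_def in_lists_conv_set split: option.splits
        dest!: spec[where x = R])
  then have "rel A = (\<lambda>R. {xs \<in> lists X. map f xs \<in> rel B R})"
    using A sub unfolding Emb_def by blast
  then show "A = pullback X B f"
    using A by (cases A) (simp add: pullback_def)
next
  assume A: "A = pullback X B f"
  have "is_structure L A"
    unfolding is_structure_def
  proof
    fix R
    show "case L R of None \<Rightarrow> rel A R = {}
          | Some k \<Rightarrow> rel A R \<subseteq> {xs. length xs = k \<and> set xs \<subseteq> carrier A}"
      using spec[OF assms(1)[unfolded is_structure_def], of R]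
      by (auto simp: A pullback_def split: option.splits)
  qed
  then show "is_structure L A \<and> carrier A = X \<and> f \<in> Emb A B"
    using assms by (simp add: A Emb_def pullback_def)
qed

definition Age :: "'r lang \<Rightarrow> ('a, 'r) struct \<Rightarrow> ('a, 'r) struct set" where
  "Age L K = {A. is_structure L A \<and> finite (carrier A) \<and> Emb A K \<noteq> {}}"

definition fraisse :: "'r lang \<Rightarrow> ('a, 'r) struct \<Rightarrow> bool" where
  "fraisse L K \<longleftrightarrow> is_structure L K \<and> countable (carrier K) \<and>
     (\<forall>A. substructure A K \<and> finite (carrier A) \<longrightarrow>
        (\<forall>f \<in> Emb A K. \<exists>g \<in> Aut K. \<forall>x \<in> carrier A. g x = f x))"

definition exhaustion :: "('a, 'r) struct \<Rightarrow> (nat \<Rightarrow> ('a, 'r) struct) \<Rightarrow> bool" where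
  "exhaustion K A \<longleftrightarrow>
     carrier (A 0) = {} \<and>
     (\<forall>n. finite (carrier (A n)) \<and> substructure (A n) K \<and> substructure (A n) (A (Suc n))) \<and>
     (\<Union>n. carrier (A n)) = carrier K"

definition iso_class :: "'r lang \<Rightarrow> (nat \<Rightarrow> ('a, 'r) struct) \<Rightarrow> ('a, 'r) struct set" where
  "iso_class L A = {B. is_structure L B \<and> (\<exists>n. isomorphic B (A n))}"

section \<open>Expansions\<close>

text \<open>\<open>fiber L \<K>s A\<close> is the set \<open>\<K>*(A)\<close> of members of the class \<open>\<K>*\<close> expanding \<open>A\<close>.\<close>

definition fiber :: "'r lang \<Rightarrow> ('a, 'r) struct set \<Rightarrow> ('a, 'r) struct \<Rightarrow> ('a, 'r) struct set" where
  "fiber L \<K>s A = {B \<in> \<K>s. reduct L B = A}"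

definition expansion ::
    "'r lang \<Rightarrow> ('a, 'r) struct set \<Rightarrow> 'r lang \<Rightarrow> ('a, 'r) struct set \<Rightarrow> bool" where
  "expansion L \<K> Ls \<K>s \<longleftrightarrow>
     L \<subseteq>\<^sub>m Ls \<and>
     (\<forall>B \<in> \<K>s. is_structure Ls B \<and> reduct L B \<in> \<K>) \<and>
     (\<forall>A \<in> \<K>. fiber L \<K>s A \<noteq> {}) \<and>
     (\<forall>A \<in> \<K>. \<forall>B \<in> \<K>s. \<forall>f \<in> Emb A (reduct L B). pullback (carrier A) B f \<in> fiber L \<K>s A)"

definition precompact :: "'r lang \<Rightarrow> ('a, 'r) struct set \<Rightarrow> ('a, 'r) struct set \<Rightarrow> bool" where
  "precompact L \<K> \<K>s \<longleftrightarrow> (\<forall>A \<in> \<K>. finite (fiber L \<K>s A))"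

definition reasonable :: "'r lang \<Rightarrow> ('a, 'r) struct set \<Rightarrow> ('a, 'r) struct set \<Rightarrow> bool" where
  "reasonable L \<K> \<K>s \<longleftrightarrow>
     (\<forall>A \<in> \<K>. \<forall>B \<in> \<K>. \<forall>f \<in> Emb A B.
        (\<lambda>Bs. pullback (carrier A) Bs f) ` fiber L \<K>s B = fiber L \<K>s A)"

definition isomorphic_expansions ::
    "'r lang \<Rightarrow> (nat \<Rightarrow> ('a, 'r) struct) \<Rightarrow> ('a, 'r) struct set \<Rightarrow> ('a, 'r) struct set \<Rightarrow> bool" where
  "isomorphic_expansions L A \<K>s \<K>d \<longleftrightarrow>
     (\<exists>\<Phi>. bij_betw \<Phi> (\<Union>n. fiber L \<K>s (A n)) (\<Union>n. fiber L \<K>d (A n)) \<and>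
          (\<forall>n. \<Phi> ` fiber L \<K>s (A n) \<subseteq> fiber L \<K>d (A n)) \<and>
          (\<forall>m n. m \<le> n \<longrightarrow> (\<forall>f \<in> Emb (A m) (A n). \<forall>B \<in> fiber L \<K>s (A n).
             \<Phi> (pullback (carrier (A m)) B f) = pullback (carrier (A m)) (\<Phi> B) f)))"

text \<open>\<open>relative_age Ls K A Ks\<close> is \<open>Age(K*/\<K>)\<close> for the \<open>Ls\<close>-structure \<open>K*\<close> expanding \<open>K\<close>.\<close>

definition relative_age ::
    "'r lang \<Rightarrow> ('a, 'r) struct \<Rightarrow> (nat \<Rightarrow> ('a, 'r) struct) \<Rightarrow> ('a, 'r) struct \<Rightarrow> ('a, 'r) struct set" where
  "relative_age Ls K A Ks =
     {B. is_structure Ls B \<and>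
         (\<exists>n. \<exists>s \<in> Emb (A n) K. isomorphic B (pullback (carrier (A n)) Ks s))}"

section \<open>Big Ramsey degrees, structures and expansions\<close>

text \<open>The degree is \<open>\<infinity>\<close> when no bound \<open>l\<close> works.\<close>

definition big_ramsey_degree :: "('a, 'r) struct \<Rightarrow> ('a, 'r) struct \<Rightarrow> enat" where
  "big_ramsey_degree K A =
     (INF l \<in> {l :: nat. \<forall>r > l. \<forall>\<gamma> \<in> Emb A K \<rightarrow> {..<r}. \<exists>\<eta> \<in> Emb K K.
                  card ((\<lambda>f. \<gamma> (compose (carrier A) \<eta> f)) ` Emb A K) \<le> l}. enat l)"

definition big_ramsey_structure ::
    "'r lang \<Rightarrow> ('a, 'r) struct \<Rightarrow> 'r lang \<Rightarrow> ('a, 'r) struct \<Rightarrow> bool" where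
  "big_ramsey_structure L K L' K' \<longleftrightarrow>
     L \<subseteq>\<^sub>m L' \<and> is_structure L' K' \<and> reduct L K' = K \<and>
     (\<forall>A \<in> Age L K.
        finite (fiber L (Age L' K') A) \<and>
        big_ramsey_degree K A = enat (card (fiber L (Age L' K') A)) \<and>
        (\<forall>\<eta> \<in> Emb K K.
           (\<lambda>f. pullback (carrier A) K' (compose (carrier A) \<eta> f)) ` Emb A K
             = fiber L (Age L' K') A))"

definition unavoidable ::
    "('a, 'r) struct \<Rightarrow> ('a, 'r) struct \<Rightarrow> ('a \<Rightarrow> 'a) set \<Rightarrow> bool" where
  "unavoidable K A S \<longleftrightarrow>
     S \<subseteq> Emb A K \<and> (\<forall>\<eta> \<in> Emb K K. {f \<in> Emb A K. compose (carrier A) \<eta> f \<in> S} \<noteq> {})"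

definition unavoidable_coloring ::
    "('a, 'r) struct \<Rightarrow> ('a, 'r) struct \<Rightarrow> enat \<Rightarrow> (('a \<Rightarrow> 'a) \<Rightarrow> 'c) \<Rightarrow> bool" where
  "unavoidable_coloring K A k \<gamma> \<longleftrightarrow>
     finite (\<gamma> ` Emb A K) \<and> enat (card (\<gamma> ` Emb A K)) = k \<and>
     (\<forall>c \<in> \<gamma> ` Emb A K. unavoidable K A {f \<in> Emb A K. \<gamma> f = c})"

text \<open>\<open>coarser K A B \<gamma> \<delta>\<close> is \<open>\<gamma> \<lless> \<delta>\<close> for colorings \<open>\<gamma>\<close> of \<open>Emb A K\<close> and \<open>\<delta>\<close> of \<open>Emb B K\<close>.\<close>

definition coarser ::
    "('a, 'r) struct \<Rightarrow> ('a, 'r) struct \<Rightarrow> ('a, 'r) struct \<Rightarrow>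
     (('a \<Rightarrow> 'a) \<Rightarrow> 'c) \<Rightarrow> (('a \<Rightarrow> 'a) \<Rightarrow> 'd) \<Rightarrow> bool" where
  "coarser K A B \<gamma> \<delta> \<longleftrightarrow>
     (\<forall>f \<in> Emb A B. \<forall>s0 \<in> Emb B K. \<forall>s1 \<in> Emb B K. \<delta> s0 = \<delta> s1 \<longrightarrow>
        \<gamma> (compose (carrier A) s0 f) = \<gamma> (compose (carrier A) s1 f))"

text \<open>Colors are natural numbers, which is no restriction as the colorings have finite image.\<close>

definition big_ramsey_expansion ::
    "'r lang \<Rightarrow> ('a, 'r) struct \<Rightarrow> (nat \<Rightarrow> ('a, 'r) struct) \<Rightarrow> 'r lang \<Rightarrow> ('a, 'r) struct set \<Rightarrow> bool" where
  "big_ramsey_expansion L K A Ls \<K>s \<longleftrightarrow>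
     expansion L (iso_class L A) Ls \<K>s \<and>
     precompact L (iso_class L A) \<K>s \<and>
     reasonable L (iso_class L A) \<K>s \<and>
     (\<forall>r. \<exists>(\<gamma> :: nat \<Rightarrow> ('a \<Rightarrow> 'a) \<Rightarrow> nat) (\<sigma> :: nat \<Rightarrow> nat \<Rightarrow> ('a, 'r) struct).
        (\<forall>n<r. unavoidable_coloring K (A n) (big_ramsey_degree K (A n)) (\<gamma> n)) \<and>
        (\<forall>m n. m \<le> n \<and> n < r \<longrightarrow> coarser K (A m) (A n) (\<gamma> m) (\<gamma> n)) \<and>
        (\<forall>n<r. bij_betw (\<sigma> n) (\<gamma> n ` Emb (A n) K) (fiber L \<K>s (A n))) \<and>
        (\<forall>m n. m \<le> n \<and> n < r \<longrightarrow> (\<forall>s \<in> Emb (A n) K. \<forall>f \<in> Emb (A m) (A n).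
           \<sigma> m (\<gamma> m (compose (carrier (A m)) s f)) =
             pullback (carrier (A m)) (\<sigma> n (\<gamma> n s)) f)))"

end

theory Submission
  imports Defs
begin

text \<open>Writing \<open>K' \<cdot> s\<close> for the expansion that \<open>K'\<close> induces along \<open>s\<close>, the maps \<open>s \<mapsto> K' \<cdot> s\<close> and
  \<open>s \<mapsto> \<sigma>\<^sub>n (\<gamma>\<^sub>n s)\<close> are two unavoidable colorings of \<open>Emb A\<^sub>n K\<close> by the members of the two
  expansions above \<open>A\<^sub>n\<close>, each using exactly as many colors as the big Ramsey degree. Along a
  self-embedding \<open>\<eta>\<close> on which their product takes at most that many values, the two colorings
  induce the same partition. Doing this successively for all \<open>n < r\<close>, matching the colors at
  \<open>\<eta> \<circ> s\<close> yields an isomorphism of the first \<open>r\<close> levels of the two expansions. As the fibers are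
  finite, a diagonal argument over \<open>r\<close> gives an isomorphism of all levels.\<close>

section \<open>Embeddings and pullbacks\<close>

lemma Emb_funcset: "f \<in> Emb A B \<Longrightarrow> f \<in> carrier A \<rightarrow> carrier B"
  by (auto simp: Emb_def)

lemma Emb_extensional: "f \<in> Emb A B \<Longrightarrow> f \<in> extensional (carrier A)"
  by (auto simp: Emb_def PiE_def)

lemma map_compose:
  assumes "xs \<in> lists X"
  shows "map (compose X g f) xs = map g (map f xs)"
  using assms by (induction xs) (auto simp: compose_def)

lemma compose_inj_on:
  assumes "inj_on f X" and "f \<in> X \<rightarrow> Y" and "inj_on g Y"
  shows "inj_on (compose X g f) X"
  using assms by (auto simp: compose_def inj_on_def Pi_iff)

lemma map_in_lists:
  assumes "f \<in> X \<rightarrow> Y" and "xs \<in> lists X"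
  shows "map f xs \<in> lists Y"
  using assms(2) by (induction xs) (use assms(1) in auto)

lemma Emb_compose:
  assumes f: "f \<in> Emb A B" and g: "g \<in> Emb B C"
  shows "compose (carrier A) g f \<in> Emb A C"
proof -
  have "compose (carrier A) g f \<in> carrier A \<rightarrow>\<^sub>E carrier C"
    using Emb_funcset[OF f] Emb_funcset[OF g] by (auto simp: compose_def)
  moreover have "inj_on (compose (carrier A) g f) (carrier A)"
    by (rule compose_inj_on[OF _ Emb_funcset[OF f]]) (use f g in \<open>simp_all add: Emb_def\<close>)
  moreover have "xs \<in> rel A R \<longleftrightarrow> map (compose (carrier A) g f) xs \<in> rel C R"
    if xs: "xs \<in> lists (carrier A)" for R xs
  proof -
    have "map f xs \<in> lists (carrier B)"
      using map_in_lists[OF Emb_funcset[OF f] xs] .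
    then show ?thesis
      using xs f g unfolding map_compose[OF xs] Emb_def by blast
  qed
  ultimately show ?thesis
    by (simp add: Emb_def)
qed

lemma substructure_Emb:
  assumes "substructure A B"
  shows "restrict (\<lambda>x. x) (carrier A) \<in> Emb A B"
proof -
  have "map (restrict (\<lambda>x. x) (carrier A)) xs = xs" if "xs \<in> lists (carrier A)" for xs
    using that by (induction xs) auto
  then show ?thesis
    using assms by (auto simp: Emb_def substructure_def inj_on_def)
qed

text \<open>Relations of a raw \<open>struct\<close> may contain lists that leave the carrier, which
  \<open>substructure\<close> cuts off; being an L-structure excludes such lists. This is what makes
  the restricted identity a self-embedding.\<close>

lemma substructure_refl:
  assumes "is_structure L A"
  shows "substructure A A"
  using assms unfolding substructure_def is_structure_def
  by (fastforce simp: in_lists_conv_set split: option.splits)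

lemma is_structure_lists:
  assumes "is_structure L A"
  shows "rel A R \<subseteq> lists (carrier A)"
  using substructure_refl[OF assms] by (auto simp: substructure_def)

lemma substructure_is_structure:
  assumes "is_structure L B" and "substructure A B"
  shows "is_structure L A"
  using assms unfolding substructure_def is_structure_def
  by (fastforce simp: in_lists_conv_set split: option.splits)

lemma is_structure_reduct:
  assumes "is_structure L' B" and "L \<subseteq>\<^sub>m L'"
  shows "is_structure L (reduct L B)"
  unfolding is_structure_def
proof
  fix R
  show "case L R of None \<Rightarrow> rel (reduct L B) R = {}
      | Some k \<Rightarrow> rel (reduct L B) R \<subseteq> {xs. length xs = k \<and> set xs \<subseteq> carrier (reduct L B)}"
  proof (cases "L R")
    case (Some k)
    then have "L' R = Some k"
      using assms(2) by (force simp: map_le_def)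
    with Some show ?thesis
      using assms(1)[unfolded is_structure_def, rule_format, of R] by (auto simp: reduct_def)
  qed (auto simp: reduct_def)
qed

section \<open>Pullbacks and reducts\<close>

lemma carrier_pullback [simp]: "carrier (pullback X B f) = X"
  by (simp add: pullback_def)

lemma carrier_reduct [simp]: "carrier (reduct L B) = carrier B"
  by (simp add: reduct_def)

lemma reduct_pullback: "reduct L (pullback X B f) = pullback X (reduct L B) f"
  by (simp add: reduct_def pullback_def fun_eq_iff)

text \<open>Functoriality of pullbacks, the source of coherence for the colorings that
  \<open>K'\<close> induces. If \<open>f\<close> left \<open>Y\<close>, the inner pullback would
  discard lists that the right-hand side may keep.\<close>

lemma pullback_compose:
  assumes "f \<in> X \<rightarrow> Y"
  shows "pullback X (pullback Y B g) f = pullback X B (compose X g f)"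
proof -
  have "map f xs \<in> rel (pullback Y B g) R \<longleftrightarrow> map (compose X g f) xs \<in> rel B R"
    if "xs \<in> lists X" for xs R
    using map_in_lists[OF assms that] map_compose[OF that, of g f]
    by (simp only: pullback_def struct.sel mem_Collect_eq simp_thms)
  then show ?thesis
    unfolding pullback_def[of X] struct.inject by blast
qed

lemma pullback_Emb:
  assumes "is_structure L A" and "f \<in> Emb A B"
  shows "pullback (carrier A) B f = A"
proof -
  have "rel A = (\<lambda>R. {xs \<in> lists (carrier A). map f xs \<in> rel B R})"
  proof
    fix R
    show "rel A R = {xs \<in> lists (carrier A). map f xs \<in> rel B R}"
      using is_structure_lists[OF assms(1), of R] assms(2) unfolding Emb_def by blast
  qed
  then show ?thesis
    by (cases A) (simp add: pullback_def)
qed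

lemma pullback_is_structure:
  assumes "is_structure L B" and "f \<in> X \<rightarrow>\<^sub>E carrier B" and "inj_on f X"
  shows "is_structure L (pullback X B f)" and "f \<in> Emb (pullback X B f) B"
  using pullback_unique[OF assms, of "pullback X B f"] by auto

lemma pullback_id:
  assumes "is_structure L B"
  shows "pullback (carrier B) B (restrict (\<lambda>x. x) (carrier B)) = B"
  using pullback_Emb[OF assms substructure_Emb[OF substructure_refl[OF assms]]] .

lemma Emb_reduct:
  assumes "f \<in> Emb A B"
  shows "f \<in> Emb (reduct L A) (reduct L B)"
  using assms by (auto simp: Emb_def reduct_def)

text \<open>Serves to carry an embedding of a structure over to the isomorphic level of the
  exhaustion.\<close>

lemma Emb_inverse:
  assumes g: "g \<in> Emb A B" and im: "g ` carrier A = carrier B"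
  defines "h \<equiv> restrict (inv_into (carrier A) g) (carrier B)"
  shows "h \<in> Emb B A" and "compose (carrier A) h g = restrict (\<lambda>x. x) (carrier A)"
proof -
  have inj: "inj_on g (carrier A)"
    using g by (simp add: Emb_def)
  have hf: "h \<in> carrier B \<rightarrow> carrier A"
    unfolding h_def im[symmetric] by (auto intro: inv_into_into)
  have gh: "map g (map h xs) = xs" if "xs \<in> lists (carrier B)" for xs
    using that unfolding h_def im[symmetric] by (induction xs) (auto simp: f_inv_into_f)
  have "inj_on h (carrier B)"
    unfolding h_def im[symmetric] by (simp add: inj_on_inv_into)
  moreover have "xs \<in> rel B R \<longleftrightarrow> map h xs \<in> rel A R" if "xs \<in> lists (carrier B)" for xs R
    using g map_in_lists[OF hf that] gh[OF that] by (auto simp: Emb_def)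
  moreover have "h \<in> carrier B \<rightarrow>\<^sub>E carrier A"
    using hf by (simp add: h_def PiE_def)
  ultimately show "h \<in> Emb B A"
    by (simp add: Emb_def)
  show "compose (carrier A) h g = restrict (\<lambda>x. x) (carrier A)"
    using inj Emb_funcset[OF g] by (auto simp: compose_def h_def fun_eq_iff)
qed

lemma compose_restrict_id:
  "f \<in> extensional X \<Longrightarrow> compose X f (restrict (\<lambda>x. x) X) = f"
  by (auto simp: compose_def fun_eq_iff extensional_def)

section \<open>Levels of the exhaustion as members of the age and of the class\<close>

lemma exhaustion_substructure:
  assumes "exhaustion K A"
  shows "substructure (A n) K" and "finite (carrier (A n))"
  using assms unfolding exhaustion_def by blast+

lemma exhaustion_Age:
  assumes "is_structure L K" and "exhaustion K A"
  shows "A n \<in> Age L K"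
proof -
  note A = exhaustion_substructure[OF assms(2), of n]
  show ?thesis
    unfolding Age_def
    using substructure_is_structure[OF assms(1) A(1)] substructure_Emb[OF A(1)] A(2) by blast
qed

lemma exhaustion_iso_class:
  assumes "is_structure L K" and "exhaustion K A"
  shows "A n \<in> iso_class L A"
proof -
  have str: "is_structure L (A n)"
    by (rule substructure_is_structure[OF assms(1) exhaustion_substructure(1)[OF assms(2)]])
  have "restrict (\<lambda>x. x) (carrier (A n)) ` carrier (A n) = carrier (A n)"
    by simp
  then have "isomorphic (A n) (A n)"
    unfolding isomorphic_def using substructure_Emb[OF substructure_refl[OF str]] by blast
  with str show ?thesis
    unfolding iso_class_def by blast
qed

section \<open>The relative age is an expansion\<close>

text \<open>Removes the isomorphism with some \<open>A n\<close> from the definition of the relative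
  age: it can be absorbed into the embedding, by composing with it in one direction and with its
  inverse in the other.\<close>

lemma fiber_relative_age:
  assumes KS: "L \<subseteq>\<^sub>m L'" "is_structure L' K'" "reduct L K' = K"
    and M: "M \<in> iso_class L A"
  shows "fiber L (relative_age L' K A K') M = (\<lambda>s. pullback (carrier M) K' s) ` Emb M K"
proof (intro equalityI subsetI)
  fix B
  assume "B \<in> fiber L (relative_age L' K A K') M"
  then obtain n s g where B: "is_structure L' B" "reduct L B = M" and s: "s \<in> Emb (A n) K"
    and g: "g \<in> Emb B (pullback (carrier (A n)) K' s)"
    unfolding fiber_def relative_age_def isomorphic_def by blast
  define t where "t = compose (carrier B) s g"
  have cB: "carrier B = carrier M"
    using B(2) by auto
  have Bt: "B = pullback (carrier M) K' t"
    using pullback_Emb[OF B(1) g] pullback_compose[of g "carrier B" "carrier (A n)" K' s]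
      Emb_funcset[OF g] by (simp add: t_def cB)
  have "inj_on t (carrier M)"
    unfolding t_def cB[symmetric] using compose_inj_on[of g "carrier B" "carrier (A n)" s] g s
    by (auto simp: Emb_def)
  moreover have "t \<in> carrier M \<rightarrow>\<^sub>E carrier K"
    using Emb_funcset[OF g] Emb_funcset[OF s] by (auto simp: t_def cB compose_def)
  \<comment> \<open>Taking reducts in \<open>Bt\<close> presents \<open>M\<close> as pulled back
    from \<open>K\<close>, so the injection \<open>t\<close> is an embedding of
    L-structures.\<close>
  moreover have "M = pullback (carrier M) K t"
    using B(2) KS(3) Bt reduct_pullback by metis
  moreover have "is_structure L K"
    using is_structure_reduct[OF KS(2,1)] KS(3) by simp
  ultimately have "t \<in> Emb M K"
    using pullback_is_structure(2) by metis
  with Bt show "B \<in> (\<lambda>s. pullback (carrier M) K' s) ` Emb M K"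
    by blast
next
  have cK: "carrier K = carrier K'"
    using KS(3) by auto
  fix B
  assume "B \<in> (\<lambda>s. pullback (carrier M) K' s) ` Emb M K"
  then obtain s where s: "s \<in> Emb M K" and B: "B = pullback (carrier M) K' s"
    by blast
  obtain n g where strM: "is_structure L M" and g: "g \<in> Emb M (A n)"
    and gim: "g ` carrier M = carrier (A n)"
    using M unfolding iso_class_def isomorphic_def by blast
  define h where "h = restrict (inv_into (carrier M) g) (carrier (A n))"
  have h: "h \<in> Emb (A n) M" and hg: "compose (carrier M) h g = restrict (\<lambda>x. x) (carrier M)"
    using Emb_inverse[OF g gim] by (simp_all add: h_def)
  \<comment> \<open>\<open>u\<close> is \<open>s\<close> transported to \<open>A n\<close>. As
    \<open>u\<close> after \<open>g\<close> is \<open>s\<close>, the map \<open>g\<close> identifies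
    \<open>B\<close> with the expansion of \<open>A n\<close> that \<open>u\<close> induces.\<close>
  define u where "u = compose (carrier (A n)) s h"
  have u: "u \<in> Emb (A n) K"
    unfolding u_def by (rule Emb_compose[OF h s])
  have ug: "compose (carrier M) u g = s"
    using compose_assoc[OF Emb_funcset[OF g], of s h] hg
      compose_restrict_id[OF Emb_extensional[OF s]] by (simp add: u_def)
  have strB: "is_structure L' B"
    unfolding B using s cK by (intro pullback_is_structure KS) (auto simp: Emb_def)
  have Bg: "B = pullback (carrier M) (pullback (carrier (A n)) K' u) g"
    using pullback_compose[OF Emb_funcset[OF g], of K' u] by (simp add: ug B)
  have "is_structure L' (pullback (carrier (A n)) K' u)"
    using u cK by (intro pullback_is_structure KS) (auto simp: Emb_def)
  then have "g \<in> Emb B (pullback (carrier (A n)) K' u)"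
    unfolding Bg using g by (intro pullback_is_structure(2)) (auto simp: Emb_def)
  then have "isomorphic B (pullback (carrier (A n)) K' u)"
    using gim by (auto simp: isomorphic_def B)
  moreover have "reduct L B = M"
    using pullback_Emb[OF strM s] by (simp add: B reduct_pullback KS(3))
  ultimately show "B \<in> fiber L (relative_age L' K A K') M"
    using strB u by (auto simp: fiber_def relative_age_def)
qed

text \<open>Fibers are nonempty because each member of the class embeds into \<open>K\<close>
  through some \<open>A n\<close>. Closure under pullback holds because pulling back a structure
  induced by \<open>s\<close> amounts to composing with \<open>s\<close>.\<close>

lemma expansion_relative_age:
  assumes KS: "L \<subseteq>\<^sub>m L'" "is_structure L' K'" "reduct L K' = K"
    and ex: "exhaustion K A"
  shows "expansion L (iso_class L A) L' (relative_age L' K A K')"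
proof -
  note fib = fiber_relative_age[OF KS]
  have strK: "is_structure L K"
    using is_structure_reduct[OF KS(2,1)] KS(3) by simp
  have red: "reduct L B \<in> iso_class L A" if BR: "B \<in> relative_age L' K A K'" for B
  proof -
    obtain n s g where B: "is_structure L' B" and s: "s \<in> Emb (A n) K"
      and g: "g \<in> Emb B (pullback (carrier (A n)) K' s)" and gim: "g ` carrier B = carrier (A n)"
      using BR unfolding relative_age_def isomorphic_def by auto
    have "is_structure L (A n)"
      by (rule substructure_is_structure[OF strK exhaustion_substructure(1)[OF ex]])
    then have "reduct L (pullback (carrier (A n)) K' s) = A n"
      using pullback_Emb[OF _ s] by (simp add: reduct_pullback KS(3))
    then have "g \<in> Emb (reduct L B) (A n)"
      using Emb_reduct[OF g, of L] by simp
    then show ?thesis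
      using is_structure_reduct[OF B KS(1)] gim by (auto simp: iso_class_def isomorphic_def)
  qed
  have ne: "fiber L (relative_age L' K A K') M \<noteq> {}" if M: "M \<in> iso_class L A" for M
  proof -
    obtain n g where "g \<in> Emb M (A n)"
      using M unfolding iso_class_def isomorphic_def by blast
    then have "compose (carrier M) (restrict (\<lambda>x. x) (carrier (A n))) g \<in> Emb M K"
      using Emb_compose substructure_Emb exhaustion_substructure[OF ex] by metis
    then show ?thesis
      unfolding fib[OF M] by blast
  qed
  have pb: "pullback (carrier M) B f \<in> fiber L (relative_age L' K A K') M"
    if M: "M \<in> iso_class L A" and B: "B \<in> relative_age L' K A K'"
      and f: "f \<in> Emb M (reduct L B)" for M B f
  proof -
    have "B \<in> fiber L (relative_age L' K A K') (reduct L B)"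
      using B by (simp add: fiber_def)
    then obtain s where s: "s \<in> Emb (reduct L B) K" and Bs: "B = pullback (carrier B) K' s"
      unfolding fib[OF red[OF B]] by auto
    have "pullback (carrier M) B f = pullback (carrier M) K' (compose (carrier M) s f)"
      using pullback_compose[of f "carrier M" "carrier B" K' s] Emb_funcset[OF f] Bs by simp
    then show ?thesis
      unfolding fib[OF M] using Emb_compose[OF f s] by blast
  qed
  show ?thesis
    unfolding expansion_def using KS(1) red ne pb by (auto simp: relative_age_def)
qed

section \<open>Coloring systems\<close>

lemma big_ramsey_degree_attained:
  assumes deg: "big_ramsey_degree K A = enat k"
    and fin: "finite (\<chi> ` Emb A K)"
  obtains \<eta> where "\<eta> \<in> Emb K K"
    and "card ((\<lambda>f. \<chi> (compose (carrier A) \<eta> f)) ` Emb A K) \<le> k"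
proof -
  define S where "S = {l :: nat. \<forall>r > l. \<forall>\<gamma> \<in> Emb A K \<rightarrow> {..<r}. \<exists>\<eta> \<in> Emb K K.
                  card ((\<lambda>f. \<gamma> (compose (carrier A) \<eta> f)) ` Emb A K) \<le> l}"
  have inf: "Inf (enat ` S) = enat k"
    using deg by (simp add: big_ramsey_degree_def S_def)
  \<comment> \<open>The infimum of the empty set is infinite, so a finite degree means that some
    bound works. By well-ordering the infimum is then attained, and \<open>k\<close> itself is such
    a bound.\<close>
  have "S \<noteq> {}"
  proof
    assume "S = {}"
    with inf show False
      by (simp add: top_enat_def)
  qed
  then obtain l where "l \<in> S"
    by blast
  then have "enat k \<in> enat ` S"
    using wellorder_InfI[of "enat l" "enat ` S"] inf by simp
  then have kS: "k \<in> S"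
    by auto
  obtain h where h: "bij_betw h (\<chi> ` Emb A K) {0..<card (\<chi> ` Emb A K)}"
    using ex_bij_betw_finite_nat[OF fin] by blast
  \<comment> \<open>The bound concerns only numbers of colors above \<open>k\<close>. The summand
    \<open>Suc k\<close> ensures this even if \<chi> has few colors, and the other summand makes
    room for the relabelled colors.\<close>
  define r where "r = Suc k + card (\<chi> ` Emb A K)"
  have "(\<lambda>f. h (\<chi> f)) \<in> Emb A K \<rightarrow> {..<r}"
  proof
    fix f
    assume "f \<in> Emb A K"
    then have "h (\<chi> f) < card (\<chi> ` Emb A K)"
      using bij_betwE[OF h] by auto
    then show "h (\<chi> f) \<in> {..<r}"
      by (simp add: r_def)
  qed
  moreover have "k < r"
    by (simp add: r_def)
  ultimately obtain \<eta> where \<eta>: "\<eta> \<in> Emb K K"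
    and le: "card ((\<lambda>f. h (\<chi> (compose (carrier A) \<eta> f))) ` Emb A K) \<le> k"
    using kS[unfolded S_def mem_Collect_eq, rule_format, of r "\<lambda>f. h (\<chi> f)"] by blast
  have sub: "(\<lambda>f. \<chi> (compose (carrier A) \<eta> f)) ` Emb A K \<subseteq> \<chi> ` Emb A K"
    using Emb_compose[OF _ \<eta>] by blast
  have "card (h ` (\<lambda>f. \<chi> (compose (carrier A) \<eta> f)) ` Emb A K) =
      card ((\<lambda>f. \<chi> (compose (carrier A) \<eta> f)) ` Emb A K)"
    using inj_on_subset[OF bij_betw_imp_inj_on[OF h] sub] by (rule card_image)
  with le that[OF \<eta>] show ?thesis
    by (simp add: image_image)
qed

text \<open>Unavoidability of the fibers means that no color disappears along \<eta>. Hence passing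
  to a self-embedding can only merge or match partitions, never reduce the number of colors.\<close>

lemma unavoidable_coloring_image:
  assumes \<gamma>: "unavoidable_coloring K A k \<gamma>" and \<eta>: "\<eta> \<in> Emb K K"
  shows "(\<lambda>f. \<gamma> (compose (carrier A) \<eta> f)) ` Emb A K = \<gamma> ` Emb A K"
proof
  show "(\<lambda>f. \<gamma> (compose (carrier A) \<eta> f)) ` Emb A K \<subseteq> \<gamma> ` Emb A K"
  proof (rule image_subsetI)
    fix f
    assume "f \<in> Emb A K"
    then show "\<gamma> (compose (carrier A) \<eta> f) \<in> \<gamma> ` Emb A K"
      by (intro imageI Emb_compose[OF _ \<eta>])
  qed
  show "\<gamma> ` Emb A K \<subseteq> (\<lambda>f. \<gamma> (compose (carrier A) \<eta> f)) ` Emb A K"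
  proof
    fix c
    assume "c \<in> \<gamma> ` Emb A K"
    then have "unavoidable K A {f \<in> Emb A K. \<gamma> f = c}"
      using \<gamma> unfolding unavoidable_coloring_def by (elim conjE) (drule (1) bspec)
    then have "{f \<in> Emb A K. compose (carrier A) \<eta> f \<in> {f \<in> Emb A K. \<gamma> f = c}} \<noteq> {}"
      using \<eta> unfolding unavoidable_def by (elim conjE) (drule (1) bspec)
    then obtain f where "f \<in> Emb A K" "\<gamma> (compose (carrier A) \<eta> f) = c"
      by auto
    then show "c \<in> (\<lambda>f. \<gamma> (compose (carrier A) \<eta> f)) ` Emb A K"
      by (intro image_eqI[of _ _ f]) simp_all
  qed
qed

section \<open>Aligning the partitions of two families of colorings\<close>

lemma Emb_compose_assoc:
  assumes "\<theta> \<in> Emb K K" and "s \<in> Emb A K"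
  shows "compose (carrier A) (compose (carrier K) \<eta> \<theta>) s =
    compose (carrier A) \<eta> (compose (carrier A) \<theta> s)"
  by (rule compose_assoc[OF Emb_funcset[OF assms(2)], symmetric])

text \<open>Stated through kernels and not through a bijection of colors, so that it passes to
  further self-embeddings without any choice.\<close>

definition same_partition ::
    "('a, 'r) struct \<Rightarrow> ('a, 'r) struct \<Rightarrow> (('a \<Rightarrow> 'a) \<Rightarrow> 'c) \<Rightarrow> (('a \<Rightarrow> 'a) \<Rightarrow> 'd) \<Rightarrow>
     ('a \<Rightarrow> 'a) \<Rightarrow> bool" where
  "same_partition K A \<gamma> \<delta> \<eta> \<longleftrightarrow>
     (\<forall>s \<in> Emb A K. \<forall>t \<in> Emb A K.
        \<gamma> (compose (carrier A) \<eta> s) = \<gamma> (compose (carrier A) \<eta> t) \<longleftrightarrow>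
        \<delta> (compose (carrier A) \<eta> s) = \<delta> (compose (carrier A) \<eta> t))"

text \<open>Copies reached through \<eta> after \<theta> are among those reached through \<eta>.
  This heredity allows the levels to be aligned one at a time.\<close>

lemma same_partition_compose:
  assumes "same_partition K A \<gamma> \<delta> \<eta>" and "\<theta> \<in> Emb K K"
  shows "same_partition K A \<gamma> \<delta> (compose (carrier K) \<eta> \<theta>)"
  unfolding same_partition_def
proof (intro ballI)
  fix s t
  assume st: "s \<in> Emb A K" "t \<in> Emb A K"
  show "\<gamma> (compose (carrier A) (compose (carrier K) \<eta> \<theta>) s) =
        \<gamma> (compose (carrier A) (compose (carrier K) \<eta> \<theta>) t) \<longleftrightarrow>
      \<delta> (compose (carrier A) (compose (carrier K) \<eta> \<theta>) s) =
        \<delta> (compose (carrier A) (compose (carrier K) \<eta> \<theta>) t)"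
    using assms(1) Emb_compose[OF st(1) assms(2)] Emb_compose[OF st(2) assms(2)]
    unfolding same_partition_def Emb_compose_assoc[OF assms(2) st(1)]
      Emb_compose_assoc[OF assms(2) st(2)] by blast
qed

text \<open>The image of the product coloring has at most \<open>k\<close> elements but projects onto two sets of
  size \<open>k\<close>, so both projections are injective.\<close>

lemma same_partition_step:
  assumes deg: "big_ramsey_degree K A = enat k"
    and \<gamma>: "unavoidable_coloring K A (enat k) \<gamma>" and \<delta>: "unavoidable_coloring K A (enat k) \<delta>"
    and \<eta>: "\<eta> \<in> Emb K K"
  obtains \<theta> where "\<theta> \<in> Emb K K" and "same_partition K A \<gamma> \<delta> (compose (carrier K) \<eta> \<theta>)"
proof -
  \<comment> \<open>The product coloring is already read along \<eta>. The \<theta> found for it is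
    therefore composed on the right, which preserves whatever \<eta> has achieved at other
    levels.\<close>
  define \<chi> where
    "\<chi> s = (\<gamma> (compose (carrier A) \<eta> s), \<delta> (compose (carrier A) \<eta> s))" for s
  have "\<chi> ` Emb A K \<subseteq> \<gamma> ` Emb A K \<times> \<delta> ` Emb A K"
  proof (rule image_subsetI)
    fix s
    assume "s \<in> Emb A K"
    then have "compose (carrier A) \<eta> s \<in> Emb A K"
      using \<eta> by (rule Emb_compose)
    then show "\<chi> s \<in> \<gamma> ` Emb A K \<times> \<delta> ` Emb A K"
      unfolding \<chi>_def by blast
  qed
  moreover have "finite (\<gamma> ` Emb A K \<times> \<delta> ` Emb A K)"
    using \<gamma> \<delta> by (simp add: unavoidable_coloring_def)
  ultimately have fin: "finite (\<chi> ` Emb A K)"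
    by (rule finite_subset)
  obtain \<theta> where \<theta>: "\<theta> \<in> Emb K K"
    and le: "card ((\<lambda>f. \<chi> (compose (carrier A) \<theta> f)) ` Emb A K) \<le> k"
    by (rule big_ramsey_degree_attained[OF deg fin])
  let ?\<eta>\<theta> = "compose (carrier K) \<eta> \<theta>"
  let ?I = "(\<lambda>f. \<chi> (compose (carrier A) \<theta> f)) ` Emb A K"
  have \<eta>\<theta>: "?\<eta>\<theta> \<in> Emb K K"
    by (rule Emb_compose[OF \<theta> \<eta>])
  have \<chi>\<theta>: "\<chi> (compose (carrier A) \<theta> s) =
      (\<gamma> (compose (carrier A) ?\<eta>\<theta> s), \<delta> (compose (carrier A) ?\<eta>\<theta> s))" if "s \<in> Emb A K" for s
    using that \<theta> by (simp add: \<chi>_def Emb_compose_assoc)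
  have finI: "finite ?I"
    using Emb_compose[OF _ \<theta>] by (intro finite_subset[OF _ fin]) blast
  have "fst ` ?I = (\<lambda>f. \<gamma> (compose (carrier A) ?\<eta>\<theta> f)) ` Emb A K"
    unfolding image_image by (intro image_cong refl) (simp add: \<chi>\<theta>)
  then have "fst ` ?I = \<gamma> ` Emb A K"
    using unavoidable_coloring_image[OF \<gamma> \<eta>\<theta>] by simp
  then have fst: "card (fst ` ?I) = k"
    using \<gamma> by (simp add: unavoidable_coloring_def)
  have "snd ` ?I = (\<lambda>f. \<delta> (compose (carrier A) ?\<eta>\<theta> f)) ` Emb A K"
    unfolding image_image by (intro image_cong refl) (simp add: \<chi>\<theta>)
  then have "snd ` ?I = \<delta> ` Emb A K"
    using unavoidable_coloring_image[OF \<delta> \<eta>\<theta>] by simp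
  then have snd: "card (snd ` ?I) = k"
    using \<delta> by (simp add: unavoidable_coloring_def)
  have inj: "inj_on fst ?I" "inj_on snd ?I"
    using le fst snd card_image_le[OF finI, of fst] card_image_le[OF finI, of snd]
    by (intro eq_card_imp_inj_on[OF finI]; linarith)+
  have "same_partition K A \<gamma> \<delta> ?\<eta>\<theta>"
    unfolding same_partition_def
  proof (intro ballI)
    fix s t
    assume st: "s \<in> Emb A K" "t \<in> Emb A K"
    show "\<gamma> (compose (carrier A) ?\<eta>\<theta> s) = \<gamma> (compose (carrier A) ?\<eta>\<theta> t) \<longleftrightarrow>
        \<delta> (compose (carrier A) ?\<eta>\<theta> s) = \<delta> (compose (carrier A) ?\<eta>\<theta> t)"
      using inj_on_eq_iff[OF inj(1) imageI[OF st(1)] imageI[OF st(2)]]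
        inj_on_eq_iff[OF inj(2) imageI[OF st(1)] imageI[OF st(2)]]
      unfolding \<chi>\<theta>[OF st(1)] \<chi>\<theta>[OF st(2)] by simp
  qed
  with \<theta> show thesis
    by (rule that)
qed

text \<open>Induction on the number of levels: start from the identity, align the new level by a
  right factor \<theta>, and keep the old levels by heredity.\<close>

lemma same_partition_simultaneous:
  fixes r :: nat
  assumes str: "is_structure L K"
    and deg: "\<And>n. n < r \<Longrightarrow> big_ramsey_degree K (A n) = enat (k n)"
    and \<gamma>: "\<And>n. n < r \<Longrightarrow> unavoidable_coloring K (A n) (enat (k n)) (\<gamma> n)"
    and \<delta>: "\<And>n. n < r \<Longrightarrow> unavoidable_coloring K (A n) (enat (k n)) (\<delta> n)"
  shows "\<exists>\<eta> \<in> Emb K K. \<forall>n<r. same_partition K (A n) (\<gamma> n) (\<delta> n) \<eta>"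
  using deg \<gamma> \<delta>
proof (induction r)
  case 0
  show ?case
    using substructure_Emb[OF substructure_refl[OF str]] by auto
next
  case (Suc r)
  have "\<exists>\<eta> \<in> Emb K K. \<forall>n<r. same_partition K (A n) (\<gamma> n) (\<delta> n) \<eta>"
    by (rule Suc.IH) (simp_all add: Suc.prems)
  then obtain \<eta> where \<eta>: "\<eta> \<in> Emb K K" "\<forall>n<r. same_partition K (A n) (\<gamma> n) (\<delta> n) \<eta>"
    by blast
  obtain \<theta> where \<theta>: "\<theta> \<in> Emb K K"
    "same_partition K (A r) (\<gamma> r) (\<delta> r) (compose (carrier K) \<eta> \<theta>)"
    using Suc.prems
    by (rule same_partition_step[of K "A r" "k r" "\<gamma> r" "\<delta> r" \<eta>, OF _ _ _ \<eta>(1)]) auto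
  have "\<forall>n<Suc r. same_partition K (A n) (\<gamma> n) (\<delta> n) (compose (carrier K) \<eta> \<theta>)"
  proof (intro allI impI)
    fix n
    assume "n < Suc r"
    then consider "n < r" | "n = r"
      by linarith
    then show "same_partition K (A n) (\<gamma> n) (\<delta> n) (compose (carrier K) \<eta> \<theta>)"
    proof cases
      case 1
      then show ?thesis
        by (intro same_partition_compose[OF _ \<theta>(1)] \<eta>(2)[rule_format])
    next
      case 2
      then show ?thesis
        using \<theta>(2) by simp
    qed
  qed
  then show ?case
    using Emb_compose[OF \<theta>(1) \<eta>(1)] by blast
qed

text \<open>The colors are the expansions themselves, so the two sides can be compared without the
  bijections \<sigma>. The last clause contains \<open>coarser\<close>, since it computes the color
  of a restricted copy from the color of the copy.\<close>

definition coloring_system ::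
    "'r lang \<Rightarrow> ('a, 'r) struct \<Rightarrow> (nat \<Rightarrow> ('a, 'r) struct) \<Rightarrow> ('a, 'r) struct set \<Rightarrow> nat \<Rightarrow>
     (nat \<Rightarrow> ('a \<Rightarrow> 'a) \<Rightarrow> ('a, 'r) struct) \<Rightarrow> bool" where
  "coloring_system L K A \<K>s r \<tau> \<longleftrightarrow>
     (\<forall>n<r. unavoidable_coloring K (A n) (big_ramsey_degree K (A n)) (\<tau> n) \<and>
        \<tau> n ` Emb (A n) K = fiber L \<K>s (A n)) \<and>
     (\<forall>m n. m \<le> n \<and> n < r \<longrightarrow> (\<forall>s \<in> Emb (A n) K. \<forall>f \<in> Emb (A m) (A n).
        \<tau> m (compose (carrier (A m)) s f) = pullback (carrier (A m)) (\<tau> n s) f))"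

lemma expansion_fiberD:
  assumes "expansion L \<K> Ls \<K>s" and "B \<in> fiber L \<K>s M"
  shows "is_structure Ls B" and "carrier B = carrier M"
proof -
  have B: "B \<in> \<K>s" "reduct L B = M"
    using assms(2) by (simp_all add: fiber_def)
  show "is_structure Ls B"
    using assms(1) B(1) unfolding expansion_def by blast
  show "carrier B = carrier M"
    using carrier_reduct[of L B] unfolding B(2) by simp
qed

lemma coloring_systemD:
  assumes "coloring_system L K A \<K>s r \<tau>" and "n < r"
  shows "unavoidable_coloring K (A n) (big_ramsey_degree K (A n)) (\<tau> n)"
    and "\<tau> n ` Emb (A n) K = fiber L \<K>s (A n)"
    and "m \<le> n \<Longrightarrow> s \<in> Emb (A n) K \<Longrightarrow> f \<in> Emb (A m) (A n) \<Longrightarrow>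
      \<tau> m (compose (carrier (A m)) s f) = pullback (carrier (A m)) (\<tau> n s) f"
  using assms unfolding coloring_system_def by blast+

text \<open>An exhaustion may repeat a structure, and then two levels could carry different
  colorings of the same copies. Coherence along the identity between the equal levels rules this
  out.\<close>

lemma coloring_system_cong:
  assumes sys: "coloring_system L K A \<K>s r \<tau>" and ex: "expansion L \<K> Ls \<K>s"
    and m: "m < r" and n: "n < r" and eq: "A m = A n" and s: "s \<in> Emb (A m) K"
    and str: "is_structure L (A m)"
  shows "\<tau> m s = \<tau> n s"
proof -
  \<comment> \<open>Coherence relates a lower index to a higher one, so the ordered case is proved
    first and then used in both directions.\<close>
  have *: "\<tau> i s = \<tau> j s" if ij: "i \<le> j" "j < r" and Aij: "A i = A m" "A j = A m" for i j
  proof -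
    have \<tau>j: "\<tau> j s \<in> fiber L \<K>s (A m)"
      using imageI[OF s, of "\<tau> j"] coloring_systemD(2)[OF sys ij(2), unfolded Aij(2)] by (simp only: simp_thms)
    note sj = expansion_fiberD[OF ex \<tau>j]
    have "pullback (carrier (A m)) (\<tau> j s) (restrict (\<lambda>x. x) (carrier (A m))) = \<tau> j s"
      using pullback_id[OF sj(1)] unfolding sj(2) .
    moreover have "restrict (\<lambda>x. x) (carrier (A m)) \<in> Emb (A m) (A m)"
      using substructure_Emb[OF substructure_refl[OF str]] .
    ultimately show ?thesis
      using coloring_systemD(3)[OF sys ij(2,1), of s "restrict (\<lambda>x. x) (carrier (A m))",
          unfolded Aij compose_restrict_id[OF Emb_extensional[OF s]], OF s] by (simp only: simp_thms)
  qed
  show ?thesis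
  proof (cases "m \<le> n")
    case True
    show ?thesis
      by (rule *[OF True n refl eq[symmetric]])
  next
    case False
    then show ?thesis
      by (intro *[symmetric]) (simp_all add: m eq)
  qed
qed

section \<open>Isomorphisms of finitely many levels\<close>

text \<open>One map on structures, shared by all levels, matches the form of
  \<open>isomorphic_expansions\<close>. For repeated or varying levels this demands that the value
  depends only on the structure.\<close>

definition level_iso ::
    "'r lang \<Rightarrow> (nat \<Rightarrow> ('a, 'r) struct) \<Rightarrow> ('a, 'r) struct set \<Rightarrow> ('a, 'r) struct set \<Rightarrow> nat \<Rightarrow>
     (('a, 'r) struct \<Rightarrow> ('a, 'r) struct) \<Rightarrow> bool" where
  "level_iso L A \<K>s \<K>d r \<Phi> \<longleftrightarrow>
     (\<forall>n<r. bij_betw \<Phi> (fiber L \<K>s (A n)) (fiber L \<K>d (A n))) \<and>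
     (\<forall>m n. m \<le> n \<and> n < r \<longrightarrow> (\<forall>f \<in> Emb (A m) (A n). \<forall>B \<in> fiber L \<K>s (A n).
        \<Phi> (pullback (carrier (A m)) B f) = pullback (carrier (A m)) (\<Phi> B) f))"

lemma level_isoD:
  assumes "level_iso L A \<K>s \<K>d r \<Phi>" and "n < r"
  shows "bij_betw \<Phi> (fiber L \<K>s (A n)) (fiber L \<K>d (A n))"
    and "m \<le> n \<Longrightarrow> f \<in> Emb (A m) (A n) \<Longrightarrow> B \<in> fiber L \<K>s (A n) \<Longrightarrow>
      \<Phi> (pullback (carrier (A m)) B f) = pullback (carrier (A m)) (\<Phi> B) f"
  using assms unfolding level_iso_def by blast+

lemma factor_through:
  assumes "\<And>x y. x \<in> X \<Longrightarrow> y \<in> X \<Longrightarrow> f x = f y \<Longrightarrow> g x = g y"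
  shows "\<exists>h. \<forall>x \<in> X. h (f x) = g x"
proof (intro exI ballI)
  \<comment> \<open>This fixes the witness: \<open>g\<close> at a chosen preimage under
    \<open>f\<close>. Its values outside the image of \<open>f\<close> are arbitrary.\<close>
  show "g (inv_into X f (f x)) = g x" if "x \<in> X" for x
    using that by (intro assms) (auto simp: inv_into_into f_inv_into_f)
qed

text \<open>With \<eta> aligning both systems, \<Phi> sends the \<tau>-color of \<eta> after
  \<open>s\<close> to its \<delta>-color. The two directions of \<open>same_partition\<close> make
  \<Phi> well defined and injective; unavoidability makes it defined on whole fibers and
  onto.\<close>

lemma coloring_systems_level_iso:
  assumes str: "is_structure L K" and ex: "exhaustion K A"
    and deg: "\<And>n. big_ramsey_degree K (A n) = enat (k n)"
    and exs: "expansion L \<K> Ls \<K>s" and exd: "expansion L \<K> Ld \<K>d"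
    and \<tau>: "coloring_system L K A \<K>s r \<tau>" and \<delta>: "coloring_system L K A \<K>d r \<delta>"
  obtains \<Phi> where "level_iso L A \<K>s \<K>d r \<Phi>"
proof -
  have unav: "unavoidable_coloring K (A n) (enat (k n)) (\<tau> n)"
    "unavoidable_coloring K (A n) (enat (k n)) (\<delta> n)"
    and fib: "\<tau> n ` Emb (A n) K = fiber L \<K>s (A n)" "\<delta> n ` Emb (A n) K = fiber L \<K>d (A n)"
    if "n < r" for n
    using coloring_systemD(1,2)[OF \<tau> that] coloring_systemD(1,2)[OF \<delta> that] unfolding deg by auto
  have strA: "is_structure L (A n)" for n
    by (rule substructure_is_structure[OF str exhaustion_substructure(1)[OF ex]])
  obtain \<eta> where \<eta>: "\<eta> \<in> Emb K K"
    and part: "\<And>n. n < r \<Longrightarrow> same_partition K (A n) (\<tau> n) (\<delta> n) \<eta>"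
    using same_partition_simultaneous[where r = r and A = A and k = k and \<gamma> = \<tau> and \<delta> = \<delta>,
        OF str deg unav] by auto
  let ?c = "\<lambda>n s. compose (carrier (A n)) \<eta> s"
  have \<eta>E: "?c n s \<in> Emb (A n) K" if "s \<in> Emb (A n) K" for n s
    using Emb_compose[OF that \<eta>] .
  \<comment> \<open>Equal colors have equal reducts, which forces \<open>A m = A n\<close>; then
    \<open>coloring_system_cong\<close> moves both copies to one level, where the partitions
    agree.\<close>
  have wd: "\<delta> m (?c m s) = \<delta> n (?c n t)"
    if mn: "m < r" "n < r" and s: "s \<in> Emb (A m) K" and t: "t \<in> Emb (A n) K"
      and eq: "\<tau> m (?c m s) = \<tau> n (?c n t)" for m n s t
  proof -
    have "\<tau> m (?c m s) \<in> fiber L \<K>s (A m)" "\<tau> n (?c n t) \<in> fiber L \<K>s (A n)"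
      using fib[OF mn(1)] fib[OF mn(2)] imageI[OF \<eta>E[OF s], of "\<tau> m"]
        imageI[OF \<eta>E[OF t], of "\<tau> n"] by simp_all
    then have A: "A m = A n"
      using eq by (auto simp: fiber_def)
    then have t': "t \<in> Emb (A m) K" and "?c n t = ?c m t"
      using t by auto
    moreover have "\<tau> m (?c m t) = \<tau> n (?c m t)" "\<delta> m (?c m t) = \<delta> n (?c m t)"
      using coloring_system_cong[OF \<tau> exs mn A \<eta>E[OF t'] strA]
        coloring_system_cong[OF \<delta> exd mn A \<eta>E[OF t'] strA] by auto
    ultimately show ?thesis
      using part[OF mn(1), unfolded same_partition_def, rule_format, OF s t'] eq
      by (simp only: simp_thms)
  qed
  \<comment> \<open>Factoring over all pairs of a level and a copy at once produces a single map for
    all levels.\<close>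
  have "\<exists>\<Phi>. \<forall>p \<in> (SIGMA n:{..<r}. Emb (A n) K).
      \<Phi> ((\<lambda>(n, s). \<tau> n (?c n s)) p) = (\<lambda>(n, s). \<delta> n (?c n s)) p"
  proof (rule factor_through)
    fix p q
    assume "p \<in> (SIGMA n:{..<r}. Emb (A n) K)" "q \<in> (SIGMA n:{..<r}. Emb (A n) K)"
      and "(\<lambda>(n, s). \<tau> n (?c n s)) p = (\<lambda>(n, s). \<tau> n (?c n s)) q"
    then show "(\<lambda>(n, s). \<delta> n (?c n s)) p = (\<lambda>(n, s). \<delta> n (?c n s)) q"
      by (cases p; cases q) (simp add: wd)
  qed
  then obtain \<Phi> where \<Phi>': "\<forall>p \<in> (SIGMA n:{..<r}. Emb (A n) K).
      \<Phi> ((\<lambda>(n, s). \<tau> n (?c n s)) p) = (\<lambda>(n, s). \<delta> n (?c n s)) p" ..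
  have \<Phi>: "\<Phi> (\<tau> n (?c n s)) = \<delta> n (?c n s)" if "n < r" "s \<in> Emb (A n) K" for n s
    using bspec[OF \<Phi>', of "(n, s)"] that by simp
  have ims: "fiber L \<K>s (A n) = (\<lambda>s. \<tau> n (?c n s)) ` Emb (A n) K"
    and imd: "fiber L \<K>d (A n) = (\<lambda>s. \<delta> n (?c n s)) ` Emb (A n) K" if "n < r" for n
    unfolding unavoidable_coloring_image[OF unav(1)[OF that] \<eta>]
      unavoidable_coloring_image[OF unav(2)[OF that] \<eta>] fib[OF that] by (rule refl)+
  have bij: "bij_betw \<Phi> (fiber L \<K>s (A n)) (fiber L \<K>d (A n))" if n: "n < r" for n
    unfolding bij_betw_def
  proof
    show "inj_on \<Phi> (fiber L \<K>s (A n))"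
      unfolding ims[OF n]
    proof (rule inj_onI, elim imageE)
      fix x y s t
      assume st: "s \<in> Emb (A n) K" "t \<in> Emb (A n) K"
        and xy: "x = \<tau> n (?c n s)" "y = \<tau> n (?c n t)" and eq: "\<Phi> x = \<Phi> y"
      have "\<delta> n (?c n s) = \<delta> n (?c n t)"
        using eq unfolding xy \<Phi>[OF n st(1)] \<Phi>[OF n st(2)] .
      then show "x = y"
        using part[OF n, unfolded same_partition_def, rule_format, OF st] unfolding xy by (simp only: simp_thms)
    qed
    show "\<Phi> ` fiber L \<K>s (A n) = fiber L \<K>d (A n)"
      unfolding ims[OF n] imd[OF n] image_image by (rule image_cong[OF refl \<Phi>[OF n]])
  qed
  have comm: "\<Phi> (pullback (carrier (A m)) B f) = pullback (carrier (A m)) (\<Phi> B) f"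
    if mn: "m \<le> n" "n < r" and f: "f \<in> Emb (A m) (A n)" and B: "B \<in> fiber L \<K>s (A n)"
    for m n f B
  proof -
    obtain s where s: "s \<in> Emb (A n) K" and Bs: "B = \<tau> n (?c n s)"
      using B unfolding ims[OF mn(2)] by blast
    let ?sf = "compose (carrier (A m)) s f"
    have sf: "?sf \<in> Emb (A m) K"
      by (rule Emb_compose[OF f s])
    \<comment> \<open>The restricted copy again runs through \<eta>, so the defining equation of
      \<Phi> applies at level \<open>m\<close> as well.\<close>
    have c: "?c m ?sf = compose (carrier (A m)) (?c n s) f"
      using compose_assoc[OF Emb_funcset[OF f], of \<eta> s] .
    have "\<tau> m (?c m ?sf) = pullback (carrier (A m)) B f"
      "\<delta> m (?c m ?sf) = pullback (carrier (A m)) (\<delta> n (?c n s)) f"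
      using coloring_systemD(3)[OF \<tau> mn(2,1) \<eta>E[OF s] f]
        coloring_systemD(3)[OF \<delta> mn(2,1) \<eta>E[OF s] f] unfolding c Bs by simp_all
    then show ?thesis
      using \<Phi>[OF le_less_trans[OF mn] sf] \<Phi>[OF mn(2) s] unfolding Bs by simp
  qed
  have "level_iso L A \<K>s \<K>d r \<Phi>"
    unfolding level_iso_def
  proof (intro conjI allI impI ballI)
    fix m n f B
    assume "m \<le> n \<and> n < r" "f \<in> Emb (A m) (A n)" "B \<in> fiber L \<K>s (A n)"
    then show "\<Phi> (pullback (carrier (A m)) B f) = pullback (carrier (A m)) (\<Phi> B) f"
      by (elim conjE) (rule comm)
  qed (rule bij)
  then show ?thesis
    by (rule that)
qed

section \<open>Compactness\<close>

text \<open>Nested infinite index sets \<open>I n\<close> are chosen such that all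
  \<open>F r\<close> with \<open>r\<close> in \<open>I n\<close> agree on \<open>X n\<close>. An
  index at least \<open>n\<close> from each \<open>I n\<close> then yields the diagonal
  limit.\<close>

lemma diagonal_choice:
  fixes F :: "nat \<Rightarrow> 'x \<Rightarrow> 'y" and X :: "nat \<Rightarrow> 'x set"
  assumes fin: "\<And>n. finite (X n)"
    and ran: "\<And>n x. x \<in> X n \<Longrightarrow> finite (range (\<lambda>r. F r x))"
  shows "\<exists>\<Phi>. \<forall>n. \<exists>r\<ge>n. \<forall>x \<in> X n. \<Phi> x = F r x"
proof -
  define P where
    "P n I \<longleftrightarrow> infinite I \<and> (\<forall>x \<in> X n. \<forall>i \<in> I. \<forall>j \<in> I. F i x = F j x)" for n I
  \<comment> \<open>On the finite set \<open>X n\<close> only finitely many restrictions of the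
    \<open>F r\<close> are possible, so one of them occurs for infinitely many indices in
    \<open>I\<close>.\<close>
  have refine: "\<exists>J. P n J \<and> J \<subseteq> I" if I: "infinite I" for I n
  proof -
    have "(\<lambda>r. restrict (F r) (X n)) ` I \<subseteq> (\<Pi>\<^sub>E x \<in> X n. range (\<lambda>r. F r x))"
      by auto
    moreover have "finite (\<Pi>\<^sub>E x \<in> X n. range (\<lambda>r. F r x))"
      by (rule finite_PiE[OF fin ran])
    ultimately have "finite ((\<lambda>r. restrict (F r) (X n)) ` I)"
      by (rule finite_subset)
    from pigeonhole_infinite[OF I this] obtain i where
      inf: "infinite {r \<in> I. restrict (F r) (X n) = restrict (F i) (X n)}" ..
    let ?J = "{r \<in> I. restrict (F r) (X n) = restrict (F i) (X n)}"
    have J: "F r x = F i x" if "r \<in> ?J" "x \<in> X n" for r x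
    proof -
      have "restrict (F r) (X n) x = restrict (F i) (X n) x"
        using that(1) by simp
      with that(2) show ?thesis
        by simp
    qed
    have "P n ?J"
      unfolding P_def
    proof (intro conjI inf ballI)
      fix x j k
      assume "x \<in> X n" "j \<in> ?J" "k \<in> ?J"
      then show "F j x = F k x"
        using J[of j x] J[of k x] by (simp only:)
    qed
    then show ?thesis
      by (intro exI[of _ ?J]) blast
  qed
  have "\<exists>I. \<forall>n. P n (I n) \<and> I (Suc n) \<subseteq> I n"
  proof (rule dependent_nat_choice)
    show "\<exists>I. P 0 I"
      using refine[OF infinite_UNIV_nat] by blast
  next
    fix I n
    assume "P n I"
    then have "infinite I"
      by (simp add: P_def)
    then show "\<exists>J. P (Suc n) J \<and> J \<subseteq> I"
      by (rule refine)
  qed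
  then obtain I where I: "\<And>n. P n (I n)" and dec: "\<And>n. I (Suc n) \<subseteq> I n"
    by blast
  have anti: "I n \<subseteq> I m" if "m \<le> n" for m n
    using lift_Suc_antimono_le[of I, OF dec that] .
  have "\<exists>r\<ge>n. r \<in> I n" for n
  proof -
    have "infinite (I n)"
      using I[of n] by (simp add: P_def)
    then show ?thesis
      unfolding infinite_nat_iff_unbounded_le by blast
  qed
  then obtain \<rho> where \<rho>: "\<And>n. \<rho> n \<ge> n" "\<And>n. \<rho> n \<in> I n"
    by metis
  \<comment> \<open>The least level containing \<open>x\<close> has the largest of the index sets
    that fix the value at \<open>x\<close>, so the index chosen for any later level containing
    \<open>x\<close> gives the same value.\<close>
  define \<Phi> where "\<Phi> x = F (\<rho> (LEAST n. x \<in> X n)) x" for x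
  have "\<Phi> x = F (\<rho> n) x" if x: "x \<in> X n" for n x
  proof -
    let ?l = "LEAST n. x \<in> X n"
    have "x \<in> X ?l" "?l \<le> n"
      using x by (auto intro: LeastI Least_le)
    moreover from this have "\<rho> n \<in> I ?l"
      using \<rho>(2) anti by blast
    ultimately show ?thesis
      using I[of ?l, unfolded P_def, THEN conjunct2, rule_format, OF _ \<rho>(2)[of ?l], of x "\<rho> n"]
      unfolding \<Phi>_def by blast
  qed
  then have "\<forall>n. \<exists>r\<ge>n. \<forall>x \<in> X n. \<Phi> x = F r x"
    using \<rho>(1) by blast
  then show ?thesis
    by (rule exI[of _ \<Phi>])
qed

text \<open>Each required property involves finitely many structures from finitely many levels, so
  it is inherited from the finite isomorphism that \<Phi> copies there.\<close>

lemma isomorphic_expansions_if_level_iso: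
  assumes exs: "expansion L \<K> Ls \<K>s" and A: "\<And>n. A n \<in> \<K>"
    and fins: "\<And>n. finite (fiber L \<K>s (A n))" and find: "\<And>n. finite (fiber L \<K>d (A n))"
    and lev: "\<And>r. \<exists>\<Phi>. level_iso L A \<K>s \<K>d r \<Phi>"
  shows "isomorphic_expansions L A \<K>s \<K>d"
proof -
  obtain F where F: "\<And>r. level_iso L A \<K>s \<K>d r (F r)"
    using lev by metis
  define X where "X n = (\<Union>m<n. fiber L \<K>s (A m))" for n
  have "finite (X n)" for n
    using fins by (simp add: X_def)
  \<comment> \<open>For \<open>r\<close> above \<open>m\<close> the values lie in the finite fiber
    over \<open>A m\<close>. For the \<open>m + 1\<close> remaining indices \<open>level_iso\<close>
    says nothing about \<open>x\<close> at level \<open>m\<close>, but they add only finitely many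
    values.\<close>
  moreover have "finite (range (\<lambda>r. F r x))" if x: "x \<in> X n" for n x
  proof -
    obtain m where m: "x \<in> fiber L \<K>s (A m)"
      using x by (auto simp: X_def)
    have "F r x \<in> fiber L \<K>d (A m)" if "m < r" for r
      by (rule bspec[OF bij_betwE[OF level_isoD(1)[OF F that]] m])
    then have "range (\<lambda>r. F r x) \<subseteq> (\<lambda>r. F r x) ` {..m} \<union> fiber L \<K>d (A m)"
      by (force simp: not_less)
    then show ?thesis
      using finite_subset find by blast
  qed
  ultimately have "\<exists>\<Phi>. \<forall>n. \<exists>r\<ge>n. \<forall>x \<in> X n. \<Phi> x = F r x"
    by (rule diagonal_choice)
  then obtain \<Phi> where \<Phi>: "\<And>n. \<exists>r\<ge>n. \<forall>x \<in> X n. \<Phi> x = F r x"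
    by blast
  have bij: "bij_betw \<Phi> (fiber L \<K>s (A n)) (fiber L \<K>d (A n))" for n
  proof -
    \<comment> \<open>Both \<open>X\<close> and \<open>level_iso\<close> count levels strictly below
      their index, so level \<open>n\<close> calls for \<open>Suc n\<close>.\<close>
    obtain r where r: "r \<ge> Suc n" "\<forall>x \<in> X (Suc n). \<Phi> x = F r x"
      using \<Phi> by blast
    have eq: "\<Phi> x = F r x" if "x \<in> fiber L \<K>s (A n)" for x
    proof -
      have "x \<in> X (Suc n)"
        using that unfolding X_def by blast
      with r(2) show ?thesis ..
    qed
    have "bij_betw (F r) (fiber L \<K>s (A n)) (fiber L \<K>d (A n))"
      using r(1) by (intro level_isoD(1)[OF F]) simp
    then show ?thesis
      using bij_betw_cong[of "fiber L \<K>s (A n)" \<Phi> "F r", OF eq] by blast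
  qed
  have comm: "\<Phi> (pullback (carrier (A m)) B f) = pullback (carrier (A m)) (\<Phi> B) f"
    if mn: "m \<le> n" and f: "f \<in> Emb (A m) (A n)" and B: "B \<in> fiber L \<K>s (A n)" for m n f B
  proof -
    obtain r where r: "r \<ge> Suc n" "\<forall>x \<in> X (Suc n). \<Phi> x = F r x"
      using \<Phi> by blast
    have "B \<in> \<K>s" "f \<in> Emb (A m) (reduct L B)"
      using f B by (simp_all add: fiber_def)
    then have "pullback (carrier (A m)) B f \<in> fiber L \<K>s (A m)"
      using exs A[of m] unfolding expansion_def by blast
    moreover have "m < Suc n"
      using mn by simp
    ultimately have "pullback (carrier (A m)) B f \<in> X (Suc n)" "B \<in> X (Suc n)"
      using B unfolding X_def by blast+
    then have "\<Phi> (pullback (carrier (A m)) B f) = F r (pullback (carrier (A m)) B f)" "\<Phi> B = F r B"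
      using r(2) by simp_all
    moreover have "n < r"
      using r(1) by simp
    ultimately show ?thesis
      using level_isoD(2)[OF F _ mn f B, of r] by simp
  qed
  \<comment> \<open>Injectivity across levels reduces to one level: a common value lies over both
    \<open>A m\<close> and \<open>A n\<close>, which must then be equal.\<close>
  have "inj_on \<Phi> (\<Union>n. fiber L \<K>s (A n))"
  proof (rule inj_onI)
    fix x y
    assume "x \<in> (\<Union>n. fiber L \<K>s (A n))" "y \<in> (\<Union>n. fiber L \<K>s (A n))" and eq: "\<Phi> x = \<Phi> y"
    then obtain m n where x: "x \<in> fiber L \<K>s (A m)" and y: "y \<in> fiber L \<K>s (A n)"
      by blast
    then have "\<Phi> x \<in> fiber L \<K>d (A m)" "\<Phi> y \<in> fiber L \<K>d (A n)"
      using bij bij_betwE by blast+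
    then have "A m = A n"
      using eq by (auto simp: fiber_def)
    then show "x = y"
      using x y eq bij_betw_imp_inj_on[OF bij[of n]] by (auto dest: inj_onD)
  qed
  moreover have "\<Phi> ` (\<Union>n. fiber L \<K>s (A n)) = (\<Union>n. fiber L \<K>d (A n))"
    unfolding image_UN using bij_betw_imp_surj_on[OF bij] by simp
  ultimately have "bij_betw \<Phi> (\<Union>n. fiber L \<K>s (A n)) (\<Union>n. fiber L \<K>d (A n))"
    by (simp add: bij_betw_def)
  then show ?thesis
    unfolding isomorphic_expansions_def using comm bij_betw_imp_surj_on[OF bij] by blast
qed

section \<open>The two coloring systems\<close>

text \<open>An injective relabelling keeps the fibers and their number. It replaces numerical colors
  by expansions.\<close>

lemma unavoidable_coloring_comp:
  assumes \<gamma>: "unavoidable_coloring K A k \<gamma>" and \<sigma>: "inj_on \<sigma> (\<gamma> ` Emb A K)"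
  shows "unavoidable_coloring K A k (\<lambda>s. \<sigma> (\<gamma> s))"
proof -
  have im: "(\<lambda>s. \<sigma> (\<gamma> s)) ` Emb A K = \<sigma> ` \<gamma> ` Emb A K"
    by (simp add: image_image)
  have "unavoidable K A {f \<in> Emb A K. \<sigma> (\<gamma> f) = c}"
    if c: "c \<in> (\<lambda>s. \<sigma> (\<gamma> s)) ` Emb A K" for c
  proof -
    obtain s where s: "s \<in> Emb A K" and c: "c = \<sigma> (\<gamma> s)"
      using c by (rule imageE)
    have "unavoidable K A {f \<in> Emb A K. \<gamma> f = \<gamma> s}"
      using \<gamma> imageI[OF s, of \<gamma>] unfolding unavoidable_coloring_def by (elim conjE) (erule (1) bspec)
    moreover have "{f \<in> Emb A K. \<sigma> (\<gamma> f) = c} = {f \<in> Emb A K. \<gamma> f = \<gamma> s}"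
      using inj_on_eq_iff[OF \<sigma> imageI imageI[OF s]] unfolding c by auto
    ultimately show ?thesis
      by simp
  qed
  moreover have "finite ((\<lambda>s. \<sigma> (\<gamma> s)) ` Emb A K)"
    "enat (card ((\<lambda>s. \<sigma> (\<gamma> s)) ` Emb A K)) = k"
    unfolding im card_image[OF \<sigma>] using \<gamma> by (simp_all add: unavoidable_coloring_def)
  ultimately show ?thesis
    unfolding unavoidable_coloring_def by (intro conjI ballI)
qed

lemma coloring_system_big_ramsey_expansion:
  fixes K :: "('a, 'r) struct"
  assumes "big_ramsey_expansion L K A Ls \<K>s"
  obtains \<tau> where "coloring_system L K A \<K>s r \<tau>"
proof -
  from assms[unfolded big_ramsey_expansion_def, THEN conjunct2, THEN conjunct2, THEN conjunct2,
      THEN spec, of r]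
  obtain \<gamma> :: "nat \<Rightarrow> ('a \<Rightarrow> 'a) \<Rightarrow> nat" and \<sigma> :: "nat \<Rightarrow> nat \<Rightarrow> ('a, 'r) struct" where
    \<gamma>: "\<forall>n<r. unavoidable_coloring K (A n) (big_ramsey_degree K (A n)) (\<gamma> n)"
    and \<sigma>: "\<forall>n<r. bij_betw (\<sigma> n) (\<gamma> n ` Emb (A n) K) (fiber L \<K>s (A n))"
    and coh: "\<forall>m n. m \<le> n \<and> n < r \<longrightarrow> (\<forall>s \<in> Emb (A n) K. \<forall>f \<in> Emb (A m) (A n).
           \<sigma> m (\<gamma> m (compose (carrier (A m)) s f)) =
             pullback (carrier (A m)) (\<sigma> n (\<gamma> n s)) f)"
    by (elim exE conjE) (rule that)
  have "coloring_system L K A \<K>s r (\<lambda>n s. \<sigma> n (\<gamma> n s))"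
    unfolding coloring_system_def
  proof (intro conjI allI impI)
    fix n
    assume n: "n < r"
    show "unavoidable_coloring K (A n) (big_ramsey_degree K (A n)) (\<lambda>s. \<sigma> n (\<gamma> n s))"
      by (rule unavoidable_coloring_comp[OF \<gamma>[rule_format, OF n]
            bij_betw_imp_inj_on[OF \<sigma>[rule_format, OF n]]])
    show "(\<lambda>s. \<sigma> n (\<gamma> n s)) ` Emb (A n) K = fiber L \<K>s (A n)"
      using bij_betw_imp_surj_on[OF \<sigma>[rule_format, OF n]] unfolding image_image .
  qed (rule coh[THEN spec, THEN spec, THEN mp])
  then show ?thesis
    by (rule that)
qed

text \<open>The copies are colored by the expansions that \<open>K'\<close> induces on them, with
  one family of colorings for every \<open>r\<close>. Coherence is functoriality of pullbacks, and
  the other clauses come from the definition of a big Ramsey structure.\<close>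

lemma coloring_system_big_ramsey_structure:
  assumes K': "big_ramsey_structure L K L' K'" and ex: "exhaustion K A"
  shows "coloring_system L K A (relative_age L' K A K') r (\<lambda>n. pullback (carrier (A n)) K')"
    and "big_ramsey_degree K (A n) = enat (card (fiber L (relative_age L' K A K') (A n)))"
    and "finite (fiber L (relative_age L' K A K') (A n))"
proof -
  have KS: "L \<subseteq>\<^sub>m L'" "is_structure L' K'" "reduct L K' = K"
    using K' by (simp_all add: big_ramsey_structure_def)
  then have str: "is_structure L K"
    using is_structure_reduct by metis
  note fib = fiber_relative_age[OF KS exhaustion_iso_class[OF str ex]]
  have brs: "finite (fiber L (Age L' K') (A n))"
    "big_ramsey_degree K (A n) = enat (card (fiber L (Age L' K') (A n)))"
    "\<And>\<eta>. \<eta> \<in> Emb K K \<Longrightarrow> (\<lambda>f. pullback (carrier (A n)) K' (compose (carrier (A n)) \<eta> f)) ` Emb (A n) K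
             = fiber L (Age L' K') (A n)" for n
    using K' exhaustion_Age[OF str ex] by (simp_all add: big_ramsey_structure_def)
  have comp_id: "compose (carrier (A n)) (restrict (\<lambda>x. x) (carrier K)) f = f"
    if "f \<in> Emb (A n) K" for n f
    using Emb_funcset[OF that] Emb_extensional[OF that]
    by (auto simp: compose_def fun_eq_iff extensional_def)
  \<comment> \<open>At the identity self-embedding, the defining equation of a big Ramsey structure
    lists the fiber in the ordinary age as the induced expansions, which also form the fiber in the
    relative age.\<close>
  have fib': "fiber L (Age L' K') (A n) = fiber L (relative_age L' K A K') (A n)" for n
    using brs(3)[OF substructure_Emb[OF substructure_refl[OF str]], of n] fib[of n]
    by (simp add: comp_id)
  show deg: "big_ramsey_degree K (A n) = enat (card (fiber L (relative_age L' K A K') (A n)))"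
    and fin: "finite (fiber L (relative_age L' K A K') (A n))" for n
    using brs(1,2) fib' by simp_all
  show "coloring_system L K A (relative_age L' K A K') r (\<lambda>n. pullback (carrier (A n)) K')"
    unfolding coloring_system_def
  proof (intro conjI allI impI ballI)
    fix n
    show im: "pullback (carrier (A n)) K' ` Emb (A n) K = fiber L (relative_age L' K A K') (A n)"
      using fib by simp
    have "unavoidable K (A n) {f \<in> Emb (A n) K. pullback (carrier (A n)) K' f = c}"
      if c: "c \<in> fiber L (relative_age L' K A K') (A n)" for c
      unfolding unavoidable_def
    proof (intro conjI ballI)
      fix \<eta>
      assume \<eta>: "\<eta> \<in> Emb K K"
      \<comment> \<open>That every expansion still occurs along \<eta> is exactly unavoidability of
        the color \<open>c\<close>.\<close>
      obtain f where "f \<in> Emb (A n) K" "pullback (carrier (A n)) K' (compose (carrier (A n)) \<eta> f) = c"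
        using c unfolding fib'[symmetric] brs(3)[OF \<eta>, symmetric] by auto
      then show "{f \<in> Emb (A n) K. compose (carrier (A n)) \<eta> f
          \<in> {f \<in> Emb (A n) K. pullback (carrier (A n)) K' f = c}} \<noteq> {}"
        using Emb_compose[OF _ \<eta>] by blast
    qed auto
    then show "unavoidable_coloring K (A n) (big_ramsey_degree K (A n)) (pullback (carrier (A n)) K')"
      unfolding unavoidable_coloring_def im using deg fin by simp
  next
    fix m n s f
    assume f: "f \<in> Emb (A m) (A n)"
    show "pullback (carrier (A m)) K' (compose (carrier (A m)) s f) =
        pullback (carrier (A m)) (pullback (carrier (A n)) K' s) f"
      by (rule pullback_compose[OF Emb_funcset[OF f], symmetric])
  qed
qed

theorem theorem7p10:
  fixes L L' L'' :: "'r lang"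
    and K K' :: "('a, 'r) struct"
    and A :: "nat \<Rightarrow> ('a, 'r) struct"
    and \<K>' :: "('a, 'r) struct set"
  assumes "fraisse L K"
    and "exhaustion K A"
    and "big_ramsey_structure L K L' K'"
    and "big_ramsey_expansion L K A L'' \<K>'"
  shows "expansion L (iso_class L A) L'' \<K>' \<and>
         expansion L (iso_class L A) L' (relative_age L' K A K') \<and>
         isomorphic_expansions L A \<K>' (relative_age L' K A K')"
proof (intro conjI)
  have str: "is_structure L K"
    using assms(1) by (simp add: fraisse_def)
  have A: "A n \<in> iso_class L A" for n
    by (rule exhaustion_iso_class[OF str assms(2)])
  show ex': "expansion L (iso_class L A) L'' \<K>'"
    by (rule assms(4)[unfolded big_ramsey_expansion_def, THEN conjunct1])
  show exr: "expansion L (iso_class L A) L' (relative_age L' K A K')"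
    using assms(2,3) by (intro expansion_relative_age) (simp_all add: big_ramsey_structure_def)
  note sys = coloring_system_big_ramsey_structure[OF assms(3,2)]
  show "isomorphic_expansions L A \<K>' (relative_age L' K A K')"
  proof (rule isomorphic_expansions_if_level_iso[OF ex' A])
    show "finite (fiber L \<K>' (A n))" for n
      using assms(4)[unfolded big_ramsey_expansion_def, THEN conjunct2, THEN conjunct1] A
      by (simp add: precompact_def)
    show "finite (fiber L (relative_age L' K A K') (A n))" for n
      by (rule sys(3))
    fix r
    \<comment> \<open>Both \<tau> and the resulting \<Phi> depend on \<open>r\<close>, with no
      relation between different \<open>r\<close>. The compactness argument reconciles them.\<close>
    obtain \<tau> where \<tau>: "coloring_system L K A \<K>' r \<tau>"
      using coloring_system_big_ramsey_expansion[OF assms(4)] .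
    obtain \<Phi> where "level_iso L A \<K>' (relative_age L' K A K') r \<Phi>"
      by (rule coloring_systems_level_iso[OF str assms(2) sys(2) ex' exr \<tau> sys(1)])
    then show "\<exists>\<Phi>. level_iso L A \<K>' (relative_age L' K A K') r \<Phi>"
      by (rule exI[of _ \<Phi>])
  qed
qed

end
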